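(* Let $A$ be a real symmetric positive definite matrix, let $l\ge1$, and let $\tau\in[0,1)$ be the tolerance used for every singular value truncation in the eSIF($l$) scheme applied to $A$. Let $\epsilon=\left[(1+\tau^2)^l-1\right]\kappa(A)$ and let $\tilde L$ be the eSIF($l$) factor. Then every eigenvalue $\lambda(\tilde L^{-1}A\tilde L^{-T})$ of the preconditioned matrix $\tilde L^{-1}A\tilde L^{-T}$ satisfies $$\frac{1}{1+\epsilon}\le\lambda(\tilde L^{-1}A\tilde L^{-T})\le1 .$$ Accordingly, $$\|\tilde L^{-1}A\tilde L^{-T}-I\|_2\le\frac{\epsilon}{1+\epsilon},\qquad \kappa(\tilde L^{-1}A\tilde L^{-T})\le1+\epsilon .$$
   Context: All matrices are real, $\|\cdot\|_2$ is the spectral norm, $\kappa(\cdot)$ is the 2-norm condition number, and Cholesky factors are lower triangular with positive diagonal entries. The eSIF scheme with truncation tolerance $\tau$ is defined recursively on symmetric positive definite (SPD) matrices. At the bottom of the recursion ("level $0$"), the factor of an SPD matrix is its exact Cholesky factor. For $l\ge1$, an eSIF($l$) factor $\tilde L$ of an SPD matrix $A$ is obtained as follows. Partition $A=\begin{pmatrix}A_{11}&A_{12}\\ A_{21}&A_{22}\end{pmatrix}$ with square diagonal blocks, $A_{21}=A_{12}^T$. Let $\tilde L_1$ and $\tilde L_2$ be the level-$(l-1)$ factors of $A_{11}$ and $A_{22}$ (exact Cholesky factors if $l=1$, eSIF($l-1$) factors obtained with the same tolerance $\tau$ if $l>1$). Let $C=\tilde L_1^{-1}A_{12}\tilde L_2^{-T}$,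 with singular values $\sigma_1\ge\sigma_2\ge\cdots\ge\sigma_k$, where $k$ is the smaller of the row and column sizes of $C$ (all $\sigma_i<1$). Choose $r$ with $\sigma_r\ge\tau\ge\sigma_{r+1}$ (conventions: the first inequality is void if $r=0$, and $\sigma_{k+1}=0$), let $\Sigma_1=\operatorname{diag}(\sigma_1,\ldots,\sigma_r)$, and let $V_1$ have as columns the corresponding $r$ leading right singular vectors of $C$. Let $\tilde D_2$ be the lower triangular Cholesky factor of $I-V_1\Sigma_1^2V_1^T$ (so $I-V_1\Sigma_1^2V_1^T=\tilde D_2\tilde D_2^T$), and set $$\tilde L=\begin{pmatrix}\tilde L_1&0\\ \tilde L_2C^T&\tilde L_2\end{pmatrix}\begin{pmatrix}I&0\\0&\tilde D_2\end{pmatrix}.$$ The truncation ranks $r$ and the block sizes may differ from one step of the recursion to another. *)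

theory Defs
  imports
    Complex_Main
    "Jordan_Normal_Form.Char_Poly"
    "Jordan_Normal_Form.Gauss_Jordan_Elimination"
begin

definition vec_norm2 :: "real vec \<Rightarrow> real" where
  "vec_norm2 x = sqrt (x \<bullet> x)"

(* Only meaningful for dim_col A > 0: otherwise the set below is empty. *)
definition spectral_norm :: "real mat \<Rightarrow> real" where
  "spectral_norm A = Sup {vec_norm2 (A *\<^sub>v x) | x. x \<in> carrier_vec (dim_col A) \<and> vec_norm2 x = 1}"

(* Unspecified if A is singular (mat_inverse is then None). *)
definition inv_mat :: "real mat \<Rightarrow> real mat" where
  "inv_mat A = the (mat_inverse A)"

definition cond2 :: "real mat \<Rightarrow> real" where
  "cond2 A = spectral_norm A * spectral_norm (inv_mat A)"

definition spd_mat :: "real mat \<Rightarrow> bool" where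
  "spd_mat A \<longleftrightarrow> square_mat A \<and> A\<^sup>T = A \<and>
     (\<forall>x \<in> carrier_vec (dim_col A). x \<noteq> 0\<^sub>v (dim_col A) \<longrightarrow> x \<bullet> (A *\<^sub>v x) > 0)"

definition cholesky_factor :: "real mat \<Rightarrow> real mat \<Rightarrow> bool" where
  "cholesky_factor A L \<longleftrightarrow> square_mat L \<and>
     (\<forall>i < dim_row L. \<forall>j < dim_col L. i < j \<longrightarrow> L $$ (i, j) = 0) \<and>
     (\<forall>i < dim_row L. L $$ (i, i) > 0) \<and>
     A = L * L\<^sup>T"

(* Full singular value decomposition. Indices start at 0: the i-th largest singular value
   is \<sigma> ! (i - 1), with the (i - 1)-st column of V as right singular vector.
   The library predicate orthogonal_mat does not require columns of length one and is
   therefore not used. *)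
definition is_svd :: "real mat \<Rightarrow> real mat \<Rightarrow> real list \<Rightarrow> real mat \<Rightarrow> bool" where
  "is_svd C U \<sigma> V \<longleftrightarrow> (let m = dim_row C; n = dim_col C in
     U \<in> carrier_mat m m \<and> U\<^sup>T * U = 1\<^sub>m m \<and>
     V \<in> carrier_mat n n \<and> V\<^sup>T * V = 1\<^sub>m n \<and>
     length \<sigma> = min m n \<and> sorted_wrt (\<ge>) \<sigma> \<and> (\<forall>s \<in> set \<sigma>. s \<ge> 0) \<and>
     C = U * mat m n (\<lambda>(i, j). if i = j then \<sigma> ! i else 0) * V\<^sup>T)"

definition truncation_rank :: "real \<Rightarrow> real list \<Rightarrow> nat \<Rightarrow> bool" where
  "truncation_rank \<tau> \<sigma> r \<longleftrightarrow> r \<le> length \<sigma> \<and>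
     (r > 0 \<longrightarrow> \<sigma> ! (r - 1) \<ge> \<tau>) \<and>
     \<tau> \<ge> (if r < length \<sigma> then \<sigma> ! r else 0)"

(* A relation rather than a function: block sizes, truncation ranks and singular vectors are
   free choices at each step. Singular values below 1 are not assumed; that
   I - V1 Sigma1^2 V1^T has a Cholesky factor already forces this for the retained ones. *)
inductive esif_factor :: "real \<Rightarrow> nat \<Rightarrow> real mat \<Rightarrow> real mat \<Rightarrow> bool" for \<tau> :: real where
  level_0: "cholesky_factor A L \<Longrightarrow> esif_factor \<tau> 0 A L"
| level_Suc: "esif_factor \<tau> (Suc l) A L"
  if "n1 > 0" "n2 > 0"
    and "A11 \<in> carrier_mat n1 n1" "A12 \<in> carrier_mat n1 n2"
    and "A21 \<in> carrier_mat n2 n1" "A22 \<in> carrier_mat n2 n2"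
    and "A = four_block_mat A11 A12 A21 A22" "A21 = A12\<^sup>T"
    and "esif_factor \<tau> l A11 L1" "esif_factor \<tau> l A22 L2"
    and "C = inv_mat L1 * A12 * (inv_mat L2)\<^sup>T"
    and "is_svd C U \<sigma> V" "truncation_rank \<tau> \<sigma> r"
    and "V1 = mat n2 r (\<lambda>(i, j). V $$ (i, j))"
    and "S1 = mat_diag r (\<lambda>i. \<sigma> ! i)"
    and "cholesky_factor (1\<^sub>m n2 - V1 * (S1 * S1) * V1\<^sup>T) D2"
    and "L = four_block_mat L1 (0\<^sub>m n1 n2) (L2 * C\<^sup>T) L2
           * four_block_mat (1\<^sub>m n1) (0\<^sub>m n1 n2) (0\<^sub>m n2 n1) D2"

end

theory Submission
  imports Defs
begin

text \<open>
  The product L L^T reproduces A12 exactly, so it differs from A only in the diagonal blocks: by the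
  errors of the factors of A11 and A22, and by L2 E L2^T, where E is the truncated part of
  C^T C and satisfies 0 \<le> E \<le> \<tau>^2 I. If x \<bullet> A x \<le> K (x \<bullet> x) for all x, then the diagonal blocks satisfy the
  same bound, and induction on the level gives 0 \<le> L L^T - A \<le> ((1 + \<tau>^2)^l - 1) K I, because
  (c - 1) + \<tau>^2 c = (1 + \<tau>^2) c - 1. With K the norm of A and I \<le> \<parallel>A^-1\<parallel> A this becomes
  A \<le> L L^T \<le> (1 + \<epsilon>) A, that is, M \<le> I \<le> (1 + \<epsilon>) M. Such inequalities between quadratic forms yield
  the norm bounds through the Cauchy-Schwarz inequality for semidefinite forms, without
  diagonalising anything.
\<close>

section \<open>Euclidean norm and the Cauchy-Schwarz inequality for semidefinite forms\<close>

lemma vec_norm2_square: "(vec_norm2 x)\<^sup>2 = x \<bullet> x"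
  and vec_norm2_nonneg: "0 \<le> vec_norm2 x"
  by (simp_all add: vec_norm2_def scalar_prod_def sum_nonneg)

lemma scalar_prod_self_nonneg: "0 \<le> x \<bullet> (x :: real vec)"
  by (simp add: scalar_prod_def sum_nonneg)

lemma vec_norm2_smult: "vec_norm2 (c \<cdot>\<^sub>v x) = \<bar>c\<bar> * vec_norm2 x"
proof -
  have "(c \<cdot>\<^sub>v x) \<bullet> (c \<cdot>\<^sub>v x) = c\<^sup>2 * (x \<bullet> x)"
    by (simp add: scalar_prod_def sum_distrib_left power2_eq_square algebra_simps)
  then show ?thesis by (simp add: vec_norm2_def real_sqrt_mult)
qed

lemma vec_norm2_eq_0: "vec_norm2 x = 0 \<longleftrightarrow> x = 0\<^sub>v (dim_vec x)"
  by (auto simp: vec_norm2_def scalar_prod_def sum_nonneg_eq_0_iff intro!: eq_vecI)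
    (metis index_zero_vec(1))

text \<open>The form at \<open>x + t y\<close> is a polynomial of degree at most two in t that is
  never negative, and its discriminant gives the bound. Only semidefiniteness is assumed, so y may
  be isotropic and the leading coefficient c may vanish. This serves the forms of A, of M and of I -
  M alike.\<close>

lemma psd_cauchy_schwarz:
  fixes A :: "real mat"
  assumes A: "A \<in> carrier_mat n n" and sym: "A\<^sup>T = A"
    and psd: "\<And>x. x \<in> carrier_vec n \<Longrightarrow> 0 \<le> x \<bullet> (A *\<^sub>v x)"
    and x: "x \<in> carrier_vec n" and y: "y \<in> carrier_vec n"
  shows "(x \<bullet> (A *\<^sub>v y))\<^sup>2 \<le> (x \<bullet> (A *\<^sub>v x)) * (y \<bullet> (A *\<^sub>v y))"
proof -
  define a b c where "a = x \<bullet> (A *\<^sub>v x)" and "b = x \<bullet> (A *\<^sub>v y)" and "c = y \<bullet> (A *\<^sub>v y)"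
  have Ax: "A *\<^sub>v x \<in> carrier_vec n" and Ay: "A *\<^sub>v y \<in> carrier_vec n" using A x y by auto
  have yx: "y \<bullet> (A *\<^sub>v x) = b"
    using transpose_vec_mult_scalar[OF A x y] sym comm_scalar_prod[OF x Ay] by (simp add: b_def)
  have q: "0 \<le> a + 2 * t * b + t\<^sup>2 * c" for t
  proof -
    have "A *\<^sub>v (x + t \<cdot>\<^sub>v y) = A *\<^sub>v x + t \<cdot>\<^sub>v (A *\<^sub>v y)"
      using A x y by (simp add: mult_add_distrib_mat_vec mult_mat_vec)
    then have "(x + t \<cdot>\<^sub>v y) \<bullet> (A *\<^sub>v (x + t \<cdot>\<^sub>v y)) = a + 2 * t * b + t\<^sup>2 * c"
      using x y Ax Ay yx
      by (simp add: add_scalar_prod_distrib[of _ n] scalar_prod_add_distrib[of _ n]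
          a_def b_def c_def power2_eq_square algebra_simps)
    then show ?thesis using psd[of "x + t \<cdot>\<^sub>v y"] x y by simp
  qed
  have c0: "0 \<le> c" using psd[OF y] by (simp add: c_def)
  have "b\<^sup>2 \<le> a * c"
  proof (cases "c = 0")
    case True
    have "b = 0"
    proof (rule ccontr)
      assume "b \<noteq> 0"
      \<comment> \<open>With c = 0 the polynomial is affine in t; this value of t makes it equal to
        -1, which contradicts \<open>q\<close>.\<close>
      then have "a + 2 * (- (a + 1) / (2 * b)) * b = - 1" by (simp add: field_simps)
      then show False using q[of "- (a + 1) / (2 * b)"] True by simp
    qed
    then show ?thesis using True by simp
  next
    case False
    \<comment> \<open>The value t = -b/c is the minimiser; the factor c clears the
      denominator.\<close>
    have "0 \<le> c * (a + 2 * (- b / c) * b + (- b / c)\<^sup>2 * c)"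
      using q[of "- b / c"] c0 by (intro mult_nonneg_nonneg)
    also have "\<dots> = a * c - b\<^sup>2"
      using False by (simp add: field_simps power2_eq_square)
    finally show ?thesis by simp
  qed
  then show ?thesis by (simp add: a_def b_def c_def)
qed

lemma scalar_prod_le_vec_norm2:
  assumes "x \<in> carrier_vec n" "y \<in> carrier_vec n"
  shows "x \<bullet> y \<le> vec_norm2 x * vec_norm2 y"
proof -
  have "(x \<bullet> y)\<^sup>2 \<le> (vec_norm2 x * vec_norm2 y)\<^sup>2"
    using psd_cauchy_schwarz[of "1\<^sub>m n" n x y] assms scalar_prod_self_nonneg
    by (simp add: power_mult_distrib vec_norm2_square)
  then show ?thesis by (rule power2_le_imp_le) (simp add: vec_norm2_nonneg)
qed

text \<open>This passes from a bound on the form to a bound on the operator without eigenvalues. For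
  z = A x, the Cauchy-Schwarz inequality of the form of A, applied to z and x, bounds (z \<bullet>
  z)^2 = (z \<bullet> A x)^2 by d^2 (z \<bullet> z) (x \<bullet> x), and one factor z \<bullet> z
  cancels.\<close>

lemma psd_vec_norm2_le:
  assumes A: "A \<in> carrier_mat n n" and sym: "A\<^sup>T = A"
    and psd: "\<And>x. x \<in> carrier_vec n \<Longrightarrow> 0 \<le> x \<bullet> (A *\<^sub>v x)"
    and le: "\<And>x. x \<in> carrier_vec n \<Longrightarrow> x \<bullet> (A *\<^sub>v x) \<le> d * (x \<bullet> x)"
    and d: "0 \<le> d" and x: "x \<in> carrier_vec n"
  shows "vec_norm2 (A *\<^sub>v x) \<le> d * vec_norm2 x"
proof -
  define z where "z = A *\<^sub>v x"
  have z: "z \<in> carrier_vec n" using A x by (simp add: z_def)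
  have "(z \<bullet> z)\<^sup>2 \<le> (z \<bullet> (A *\<^sub>v z)) * (x \<bullet> (A *\<^sub>v x))"
    using psd_cauchy_schwarz[OF A sym psd z x] by (simp add: z_def)
  also have "\<dots> \<le> (d * (z \<bullet> z)) * (d * (x \<bullet> x))"
    by (intro mult_mono le z x psd mult_nonneg_nonneg d scalar_prod_self_nonneg)
  finally have *: "(z \<bullet> z) * (z \<bullet> z) \<le> (z \<bullet> z) * (d\<^sup>2 * (x \<bullet> x))"
    by (simp add: power2_eq_square mult_ac)
  have "z \<bullet> z \<le> d\<^sup>2 * (x \<bullet> x)"
  proof (cases "z \<bullet> z = 0")
    case True
    then show ?thesis using scalar_prod_self_nonneg[of x] by simp
  next
    case False
    then show ?thesis using * scalar_prod_self_nonneg[of z] by simp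
  qed
  then have "(vec_norm2 z)\<^sup>2 \<le> (d * vec_norm2 x)\<^sup>2"
    by (simp add: power_mult_distrib vec_norm2_square)
  then show ?thesis
    unfolding z_def by (rule power2_le_imp_le) (simp add: d vec_norm2_nonneg)
qed

section \<open>The spectral norm as a supremum\<close>

lemma spectral_norm_le:
  assumes B: "B \<in> carrier_mat m n" and n: "0 < n"
    and le: "\<And>x. x \<in> carrier_vec n \<Longrightarrow> vec_norm2 (B *\<^sub>v x) \<le> c * vec_norm2 x"
  shows "spectral_norm B \<le> c"
proof -
  \<comment> \<open>A real supremum is bounded by upper bounds only over a nonempty set; since n is
    positive, the first unit vector is a witness.\<close>
  have "vec_norm2 (unit_vec n 0) = 1"
    using n by (simp add: vec_norm2_def)
  then have "vec_norm2 (B *\<^sub>v unit_vec n 0) \<in>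
      {vec_norm2 (B *\<^sub>v x) | x. x \<in> carrier_vec (dim_col B) \<and> vec_norm2 x = 1}"
    using B unit_vec_carrier by blast
  moreover have "s \<le> c"
    if "s \<in> {vec_norm2 (B *\<^sub>v x) | x. x \<in> carrier_vec (dim_col B) \<and> vec_norm2 x = 1}" for s
    using that le B by fastforce
  ultimately show ?thesis
    unfolding spectral_norm_def by (intro cSup_least) blast+
qed

text \<open>Cauchy-Schwarz in each row gives the Frobenius norm as an upper bound. Boundedness is
  what allows \<open>cSup_upper\<close> to be applied to \<open>spectral_norm\<close>.\<close>

lemma bdd_above_spectral_norm:
  assumes B: "B \<in> carrier_mat m n"
  shows "bdd_above {vec_norm2 (B *\<^sub>v x) | x. x \<in> carrier_vec (dim_col B) \<and> vec_norm2 x = 1}"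
proof (rule bdd_aboveI)
  fix s assume "s \<in> {vec_norm2 (B *\<^sub>v x) | x. x \<in> carrier_vec (dim_col B) \<and> vec_norm2 x = 1}"
  then obtain x where x: "x \<in> carrier_vec n" "vec_norm2 x = 1" and s: "s = vec_norm2 (B *\<^sub>v x)"
    using B by auto
  have "(row B i \<bullet> x)\<^sup>2 \<le> row B i \<bullet> row B i" if "i < m" for i
    using psd_cauchy_schwarz[of "1\<^sub>m n" n "row B i" x] B x scalar_prod_self_nonneg that
      vec_norm2_square[of x]
    by simp
  then have "(B *\<^sub>v x) \<bullet> (B *\<^sub>v x) \<le> (\<Sum>i<m. row B i \<bullet> row B i)"
    using B by (auto simp: scalar_prod_def[of "B *\<^sub>v x"] power2_eq_square lessThan_atLeast0
        intro!: sum_mono)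
  then show "s \<le> sqrt (\<Sum>i<m. row B i \<bullet> row B i)"
    by (simp add: s vec_norm2_def)
qed

lemma vec_norm2_mult_le_spectral_norm:
  assumes B: "B \<in> carrier_mat m n" and x: "x \<in> carrier_vec n"
  shows "vec_norm2 (B *\<^sub>v x) \<le> spectral_norm B * vec_norm2 x"
proof (cases "vec_norm2 x = 0")
  case True
  \<comment> \<open>A zero vector cannot be normalised. This case also absorbs n = 0, where the
    supremum ranges over the empty set.\<close>
  then have "x = 0\<^sub>v n" using x by (simp add: vec_norm2_eq_0)
  then have "B *\<^sub>v x = 0\<^sub>v m" using B by (auto intro!: eq_vecI)
  then show ?thesis using True by (simp add: vec_norm2_def)
next
  case False
  define c where "c = vec_norm2 x"
  have c: "c > 0" using False vec_norm2_nonneg[of x] by (simp add: c_def)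
  have "vec_norm2 (B *\<^sub>v ((1 / c) \<cdot>\<^sub>v x)) \<le> spectral_norm B"
    unfolding spectral_norm_def
  proof (rule cSup_upper[OF _ bdd_above_spectral_norm[OF B]])
    show "vec_norm2 (B *\<^sub>v ((1 / c) \<cdot>\<^sub>v x)) \<in>
      {vec_norm2 (B *\<^sub>v x) | x. x \<in> carrier_vec (dim_col B) \<and> vec_norm2 x = 1}"
      using B x c by (auto simp: vec_norm2_smult c_def intro!: exI[of _ "(1 / c) \<cdot>\<^sub>v x"])
  qed
  then show ?thesis
    using c B x by (simp add: mult_mat_vec vec_norm2_smult c_def[symmetric] field_simps)
qed

lemma spectral_norm_nonneg:
  assumes B: "B \<in> carrier_mat m n" and n: "0 < n"
  shows "0 \<le> spectral_norm B"
proof -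
  have "0 \<le> vec_norm2 (B *\<^sub>v unit_vec n 0)" by (rule vec_norm2_nonneg)
  also have "\<dots> \<le> spectral_norm B * vec_norm2 (unit_vec n 0)"
    by (rule vec_norm2_mult_le_spectral_norm[OF B]) simp
  finally show ?thesis using n by (simp add: vec_norm2_def)
qed

section \<open>Inverses and exact Cholesky factors\<close>

text \<open>Nothing is known about \<open>inv_mat\<close> before invertibility is established. All
  inverses in the proof are therefore accessed through a nonzero determinant, which is why
  determinants are carried along the recursion.\<close>

lemma inv_mat_det_nonzero:
  assumes A: "A \<in> carrier_mat n n" and det: "det A \<noteq> 0"
  shows "inv_mat A \<in> carrier_mat n n" "A * inv_mat A = 1\<^sub>m n" "inv_mat A * A = 1\<^sub>m n"
proof -
  have "mat_inverse A \<noteq> None"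
    using mat_inverse(1)[OF A, of "()"] det_non_zero_imp_unit[OF A det, of "()"] by blast
  then have "mat_inverse A = Some (inv_mat A)" by (auto simp: inv_mat_def)
  from mat_inverse(2)[OF A this]
  show "inv_mat A \<in> carrier_mat n n" "A * inv_mat A = 1\<^sub>m n" "inv_mat A * A = 1\<^sub>m n" by auto
qed

lemma cholesky_factor_carrier:
  assumes "cholesky_factor A L" "A \<in> carrier_mat n n"
  shows "L \<in> carrier_mat n n"
  using assms by (intro carrier_matI) (auto simp: cholesky_factor_def square_mat.simps)

lemma cholesky_factor_det:
  assumes ch: "cholesky_factor A L" and A: "A \<in> carrier_mat n n"
  shows "det L \<noteq> 0"
proof -
  have L: "L \<in> carrier_mat n n" by (rule cholesky_factor_carrier[OF ch A])
  have "det L = prod_list (diag_mat L)"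
    using ch L by (intro det_lower_triangular[of n]) (auto simp: cholesky_factor_def)
  moreover have "0 \<notin> set (diag_mat L)"
    using ch L by (force simp: cholesky_factor_def diag_mat_def)
  ultimately show ?thesis by (simp add: prod_list_zero_iff)
qed

text \<open>A factor is compared with its matrix through the form of \<open>L * L\<^sup>T\<close>,
  written as a squared norm. An exact factor has no error: this is the base of the induction, and it
  also evaluates the contribution of \<open>D2\<close>.\<close>

lemma cholesky_factor_quadratic_form:
  assumes ch: "cholesky_factor A L" and A: "A \<in> carrier_mat n n" and x: "x \<in> carrier_vec n"
  shows "(L\<^sup>T *\<^sub>v x) \<bullet> (L\<^sup>T *\<^sub>v x) = x \<bullet> (A *\<^sub>v x)"
proof -
  have L: "L \<in> carrier_mat n n" by (rule cholesky_factor_carrier[OF ch A])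
  have LT: "L\<^sup>T \<in> carrier_mat n n" using L by simp
  have "A *\<^sub>v x = L *\<^sub>v (L\<^sup>T *\<^sub>v x)"
    using ch assoc_mult_mat_vec[OF L LT x] by (simp add: cholesky_factor_def)
  then show ?thesis
    using transpose_vec_mult_scalar[OF L, of "L\<^sup>T *\<^sub>v x" x] L LT x by simp
qed

section \<open>One level of the scheme: truncation error and block factor\<close>

text \<open>In the coordinates z = V^T w, the squared norm of C w is the sum of all (\<sigma>_i
  z_i)^2, and the retained matrix contributes exactly the first r terms. The remaining tail is
  nonnegative and at most \<tau>^2 (z \<bullet> z) = \<tau>^2 (w \<bullet> w).\<close>

lemma svd_truncation:
  assumes C: "C \<in> carrier_mat m n" and svd: "is_svd C U \<sigma> V" and tr: "truncation_rank \<tau> \<sigma> r"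
    and w: "w \<in> carrier_vec n"
    and V1: "V1 = mat n r (\<lambda>(i, j). V $$ (i, j))" and S1: "S1 = mat_diag r (\<lambda>i. \<sigma> ! i)"
    and \<tau>: "0 \<le> \<tau>"
  shows "w \<bullet> ((V1 * (S1 * S1) * V1\<^sup>T) *\<^sub>v w) \<le> (C *\<^sub>v w) \<bullet> (C *\<^sub>v w)"
    and "(C *\<^sub>v w) \<bullet> (C *\<^sub>v w) \<le> w \<bullet> ((V1 * (S1 * S1) * V1\<^sup>T) *\<^sub>v w) + \<tau>\<^sup>2 * (w \<bullet> w)"
proof -
  define k where "k = min m n"
  define S where "S = mat m n (\<lambda>(i, j). if i = j then \<sigma> ! i else 0)"
  have U: "U \<in> carrier_mat m m" "U\<^sup>T * U = 1\<^sub>m m"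
    and V: "V \<in> carrier_mat n n" "V\<^sup>T * V = 1\<^sub>m n"
    and len: "length \<sigma> = k" and sorted: "sorted_wrt (\<ge>) \<sigma>" and pos: "\<And>i. i < k \<Longrightarrow> 0 \<le> \<sigma> ! i"
    and CS: "C = U * S * V\<^sup>T"
    using svd C by (auto simp: is_svd_def Let_def k_def S_def)
  have r: "r \<le> k" using tr len by (simp add: truncation_rank_def)
  have kn: "k \<le> n" "k \<le> m" by (auto simp: k_def)
  have S: "S \<in> carrier_mat m n" by (simp add: S_def)
  define z where "z = V\<^sup>T *\<^sub>v w"
  have z: "z \<in> carrier_vec n" using V w by (simp add: z_def)
  have VT: "V\<^sup>T \<in> carrier_mat n n" using V by simp
  \<comment> \<open>For a square V the identity in \<open>is_svd\<close> yields the reverse product,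
    so \<open>V\<^sup>T\<close> preserves lengths.\<close>
  have VV: "V * V\<^sup>T = 1\<^sub>m n"
    using mat_mult_left_right_inverse[OF VT V(1) V(2)] .
  have "V *\<^sub>v z = w"
    using assoc_mult_mat_vec[OF V(1) VT w] VV w by (simp add: z_def)
  then have zz: "z \<bullet> z = w \<bullet> w"
    using transpose_vec_mult_scalar[OF V(1) z w] by (simp add: z_def)
  have Cw: "C *\<^sub>v w = U *\<^sub>v (S *\<^sub>v z)"
    unfolding CS z_def assoc_mult_mat_vec[OF mult_carrier_mat[OF U(1) S] VT w]
    by (rule assoc_mult_mat_vec[OF U(1) S z[unfolded z_def]])
  have Sz: "S *\<^sub>v z \<in> carrier_vec m" using S z by simp
  have "U\<^sup>T *\<^sub>v (U *\<^sub>v (S *\<^sub>v z)) = S *\<^sub>v z"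
    using assoc_mult_mat_vec[of "U\<^sup>T" m m U m "S *\<^sub>v z"] U Sz by simp
  then have "(C *\<^sub>v w) \<bullet> (C *\<^sub>v w) = (S *\<^sub>v z) \<bullet> (S *\<^sub>v z)"
    using transpose_vec_mult_scalar[OF U(1) Sz, of "U *\<^sub>v (S *\<^sub>v z)"] U Sz
      by (simp add: Cw)
  also have "\<dots> = (\<Sum>i<k. (\<sigma> ! i * z $ i)\<^sup>2)"
  proof -
    \<comment> \<open>S is rectangular: for m > n its rows from index k on vanish.\<close>
    have "(S *\<^sub>v z) $ i = (if i < k then \<sigma> ! i * z $ i else 0)" if "i < m" for i
    proof -
      have "(S *\<^sub>v z) $ i = (\<Sum>j = 0..<n. (if i = j then \<sigma> ! i else 0) * z $ j)"
        using that z by (simp add: S_def scalar_prod_def)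
      also have "\<dots> = (\<Sum>j = 0..<n. if i = j then \<sigma> ! i * z $ i else 0)"
        by (rule sum.cong) auto
      finally show ?thesis using that by (simp add: k_def)
    qed
    then have "(S *\<^sub>v z) \<bullet> (S *\<^sub>v z) = (\<Sum>i<m. if i < k then (\<sigma> ! i * z $ i)\<^sup>2 else 0)"
      using S by (auto simp: scalar_prod_def[of _ "S *\<^sub>v z"] power2_eq_square lessThan_atLeast0
          simp del: index_mult_mat_vec intro!: sum.cong)
    also have "\<dots> = (\<Sum>i<k. (\<sigma> ! i * z $ i)\<^sup>2)"
      using kn by (intro sum.mono_neutral_cong_right) auto
    finally show ?thesis .
  qed
  finally have full: "(C *\<^sub>v w) \<bullet> (C *\<^sub>v w) = (\<Sum>i<k. (\<sigma> ! i * z $ i)\<^sup>2)" .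
  have V1c: "V1 \<in> carrier_mat n r" and S1c: "S1 \<in> carrier_mat r r" by (auto simp: V1 S1)
  have V1w: "(V1\<^sup>T *\<^sub>v w) $ i = z $ i" if "i < r" for i
    using that V w r kn by (simp add: V1 z_def) (auto simp: scalar_prod_def intro!: sum.cong)
  define y where "y = V1\<^sup>T *\<^sub>v w"
  have y: "y \<in> carrier_vec r" using V1c w by (simp add: y_def)
  have Sy: "(S1 * S1) *\<^sub>v y = vec r (\<lambda>i. (\<sigma> ! i)\<^sup>2 * y $ i)"
  proof (rule eq_vecI)
    fix i assume "i < dim_vec (vec r (\<lambda>i. (\<sigma> ! i)\<^sup>2 * y $ i))"
    then have i: "i < r" by simp
    then have "((S1 * S1) *\<^sub>v y) $ i = (\<Sum>j = 0..<r. (if i = j then \<sigma> ! j * \<sigma> ! j else 0) * y $ j)"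
      using y unfolding S1 mat_diag_diag by (simp add: mat_diag_def scalar_prod_def)
    also have "\<dots> = (\<Sum>j = 0..<r. if i = j then (\<sigma> ! i)\<^sup>2 * y $ i else 0)"
      by (rule sum.cong) (auto simp: power2_eq_square)
    finally show "((S1 * S1) *\<^sub>v y) $ i = vec r (\<lambda>i. (\<sigma> ! i)\<^sup>2 * y $ i) $ i"
      using i by simp
  qed (simp add: S1 mat_diag_def)
  have "(V1 * (S1 * S1) * V1\<^sup>T) *\<^sub>v w = V1 *\<^sub>v ((S1 * S1) *\<^sub>v y)"
    unfolding y_def
    using assoc_mult_mat_vec[of "V1 * (S1 * S1)" n r "V1\<^sup>T" n w]
      assoc_mult_mat_vec[of V1 n r "S1 * S1" r y] V1c S1c w y
    by (simp add: y_def del: assoc_mult_mat mat_diag_diag)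
  then have "w \<bullet> ((V1 * (S1 * S1) * V1\<^sup>T) *\<^sub>v w) = y \<bullet> ((S1 * S1) *\<^sub>v y)"
    using transpose_vec_mult_scalar[OF V1c _ w, of "(S1 * S1) *\<^sub>v y"] S1c y by (simp add: y_def)
  also have "\<dots> = (\<Sum>i<r. (\<sigma> ! i * z $ i)\<^sup>2)"
    unfolding Sy using V1w
    by (auto simp: scalar_prod_def y_def[symmetric] power2_eq_square lessThan_atLeast0 intro!: sum.cong)
  finally have part: "w \<bullet> ((V1 * (S1 * S1) * V1\<^sup>T) *\<^sub>v w) = (\<Sum>i<r. (\<sigma> ! i * z $ i)\<^sup>2)" .
  have "{..<k} = {..<r} \<union> {r..<k}" using r by auto
  then have split: "(\<Sum>i<k. (\<sigma> ! i * z $ i)\<^sup>2) = (\<Sum>i<r. (\<sigma> ! i * z $ i)\<^sup>2) + (\<Sum>i=r..<k. (\<sigma> ! i * z $ i)\<^sup>2)"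
    by (simp add: sum.union_disjoint[symmetric] ivl_disj_int)
  show "w \<bullet> ((V1 * (S1 * S1) * V1\<^sup>T) *\<^sub>v w) \<le> (C *\<^sub>v w) \<bullet> (C *\<^sub>v w)"
    unfolding full part split by (simp add: sum_nonneg)
  \<comment> \<open>Indices start at 0, so \<open>\<sigma> ! r\<close> is the first discarded
    singular value. For r = k the range is empty, and the convention that a missing value is 0 is
    never reached.\<close>
  have small: "\<sigma> ! i \<le> \<tau>" if "r \<le> i" "i < k" for i
  proof -
    have "\<sigma> ! i \<le> \<sigma> ! r"
      using sorted that len by (cases "i = r") (auto simp: sorted_wrt_iff_nth_less)
    also have "\<dots> \<le> \<tau>" using tr that len by (auto simp: truncation_rank_def)
    finally show ?thesis .
  qed
  \<comment> \<open>Squaring the bound uses that singular values are nonnegative. Afterwards the sum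
    is enlarged to all n coordinates in order to reach z \<bullet> z.\<close>
  have "(\<Sum>i=r..<k. (\<sigma> ! i * z $ i)\<^sup>2) \<le> (\<Sum>i=r..<k. \<tau>\<^sup>2 * (z $ i)\<^sup>2)"
    using small pos by (intro sum_mono) (auto simp: power_mult_distrib intro!: mult_right_mono power_mono)
  also have "\<dots> \<le> (\<Sum>i<n. \<tau>\<^sup>2 * (z $ i)\<^sup>2)"
    using kn by (intro sum_mono2) auto
  also have "\<dots> = \<tau>\<^sup>2 * (z \<bullet> z)"
    using z by (simp add: scalar_prod_def power2_eq_square lessThan_atLeast0 sum_distrib_left)
  finally show "(C *\<^sub>v w) \<bullet> (C *\<^sub>v w) \<le> w \<bullet> ((V1 * (S1 * S1) * V1\<^sup>T) *\<^sub>v w) + \<tau>\<^sup>2 * (w \<bullet> w)"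
    unfolding full part split zz by simp
qed

text \<open>With u = L1^T x1 and w = L2^T x2, applying \<open>L\<^sup>T\<close> gives the blocks u +
  C w and D2^T w. The cross term is that of A, because C was obtained from A12 by scaling that
  undoes itself. What remains besides u \<bullet> u and w \<bullet> w is the truncation error, which
  lies between 0 and \<tau>^2 (w \<bullet> w). The bounds refer to the forms of L1 and L2, not of
  A11 and A22, so that the errors of the lower levels can be inserted later.\<close>

lemma esif_step:
  assumes L1: "L1 \<in> carrier_mat n1 n1" "det L1 \<noteq> 0" and L2: "L2 \<in> carrier_mat n2 n2" "det L2 \<noteq> 0"
    and A12: "A12 \<in> carrier_mat n1 n2"
    and C: "C = inv_mat L1 * A12 * (inv_mat L2)\<^sup>T"
    and svd: "is_svd C U \<sigma> V" and tr: "truncation_rank \<tau> \<sigma> r"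
    and V1: "V1 = mat n2 r (\<lambda>(i, j). V $$ (i, j))" and S1: "S1 = mat_diag r (\<lambda>i. \<sigma> ! i)"
    and D2: "cholesky_factor (1\<^sub>m n2 - V1 * (S1 * S1) * V1\<^sup>T) D2"
    and L: "L = four_block_mat L1 (0\<^sub>m n1 n2) (L2 * C\<^sup>T) L2
           * four_block_mat (1\<^sub>m n1) (0\<^sub>m n1 n2) (0\<^sub>m n2 n1) D2"
    and \<tau>: "0 \<le> \<tau>"
  shows "L \<in> carrier_mat (n1 + n2) (n1 + n2)" and "det L \<noteq> 0"
    and "\<And>x1 x2. x1 \<in> carrier_vec n1 \<Longrightarrow> x2 \<in> carrier_vec n2 \<Longrightarrow>
        (L1\<^sup>T *\<^sub>v x1) \<bullet> (L1\<^sup>T *\<^sub>v x1) + (L2\<^sup>T *\<^sub>v x2) \<bullet> (L2\<^sup>T *\<^sub>v x2) + 2 * (x1 \<bullet> (A12 *\<^sub>v x2))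
          \<le> (L\<^sup>T *\<^sub>v (x1 @\<^sub>v x2)) \<bullet> (L\<^sup>T *\<^sub>v (x1 @\<^sub>v x2))"
    and "\<And>x1 x2. x1 \<in> carrier_vec n1 \<Longrightarrow> x2 \<in> carrier_vec n2 \<Longrightarrow>
        (L\<^sup>T *\<^sub>v (x1 @\<^sub>v x2)) \<bullet> (L\<^sup>T *\<^sub>v (x1 @\<^sub>v x2))
          \<le> (L1\<^sup>T *\<^sub>v x1) \<bullet> (L1\<^sup>T *\<^sub>v x1) + (1 + \<tau>\<^sup>2) * ((L2\<^sup>T *\<^sub>v x2) \<bullet> (L2\<^sup>T *\<^sub>v x2))
            + 2 * (x1 \<bullet> (A12 *\<^sub>v x2))"
proof -
  note I1 = inv_mat_det_nonzero[OF L1] and I2 = inv_mat_det_nonzero[OF L2]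
  have Cc: "C \<in> carrier_mat n1 n2" using I1(1) I2(1) A12 by (simp add: C)
  define T where "T = V1 * (S1 * S1) * V1\<^sup>T"
  have V1c: "V1 \<in> carrier_mat n2 r" and S1c: "S1 \<in> carrier_mat r r" by (auto simp: V1 S1)
  have T: "T \<in> carrier_mat n2 n2"
    unfolding T_def by (intro mult_carrier_mat[of _ n2 r] V1c mult_carrier_mat[OF S1c S1c] transpose_carrier_mat[THEN iffD2])
  have IT: "1\<^sub>m n2 - T \<in> carrier_mat n2 n2" using T by (rule minus_carrier_mat)
  have D2': "cholesky_factor (1\<^sub>m n2 - T) D2" using D2 by (simp add: T_def)
  have D2c: "D2 \<in> carrier_mat n2 n2" and D2d: "det D2 \<noteq> 0"
    using cholesky_factor_carrier[OF D2' IT] cholesky_factor_det[OF D2' IT] .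
  have LC: "L2 * C\<^sup>T \<in> carrier_mat n2 n1" using L2 Cc by simp
  define P Q where "P = four_block_mat L1 (0\<^sub>m n1 n2) (L2 * C\<^sup>T) L2"
    and "Q = four_block_mat (1\<^sub>m n1) (0\<^sub>m n1 n2) (0\<^sub>m n2 n1) D2"
  have P: "P \<in> carrier_mat (n1 + n2) (n1 + n2)" and Q: "Q \<in> carrier_mat (n1 + n2) (n1 + n2)"
    using L1 L2 D2c by (auto simp: P_def Q_def)
  have LPQ: "L = P * Q" by (simp add: L P_def Q_def)
  show "L \<in> carrier_mat (n1 + n2) (n1 + n2)" using P Q by (simp add: LPQ)
  have "det P = det L1 * det L2"
    unfolding P_def by (rule det_four_block_mat_upper_right_zero[OF L1(1) refl LC L2(1)])
  moreover have "det Q = det (1\<^sub>m n1 :: real mat) * det D2"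
    unfolding Q_def by (rule det_four_block_mat_upper_right_zero[OF _ refl _ D2c]) auto
  ultimately show "det L \<noteq> 0"
    using L1 L2 D2d by (simp add: LPQ det_mult[OF P Q])
  have PT: "P\<^sup>T = four_block_mat L1\<^sup>T (C * L2\<^sup>T) (0\<^sub>m n2 n1) L2\<^sup>T"
    unfolding P_def using transpose_four_block_mat[OF L1(1) zero_carrier_mat LC L2(1)]
      transpose_mult[OF L2(1), of "C\<^sup>T" n1] Cc by simp
  have QT: "Q\<^sup>T = four_block_mat (1\<^sub>m n1) (0\<^sub>m n1 n2) (0\<^sub>m n2 n1) D2\<^sup>T"
    unfolding Q_def using transpose_four_block_mat[OF one_carrier_mat zero_carrier_mat zero_carrier_mat D2c]
    by simp
  \<comment> \<open>The off-diagonal block is reproduced without error even when L1 and L2 are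
    themselves approximate.\<close>
  have A12_eq: "L1 * C * L2\<^sup>T = A12"
  proof -
    have "(inv_mat L2)\<^sup>T * L2\<^sup>T = 1\<^sub>m n2"
      using transpose_mult[OF L2(1) I2(1)] I2(2) by simp
    then have "(inv_mat L1 * A12) * (inv_mat L2)\<^sup>T * L2\<^sup>T = inv_mat L1 * A12"
      using assoc_mult_mat[of "inv_mat L1 * A12" n1 n2 "(inv_mat L2)\<^sup>T" n2 "L2\<^sup>T" n2] I1(1) I2(1) A12 L2(1)
      by simp
    then have "L1 * (C * L2\<^sup>T) = L1 * (inv_mat L1 * A12)" by (simp add: C)
    also have "\<dots> = A12"
      using assoc_mult_mat[OF L1(1) I1(1) A12] I1(2) A12 by simp
    finally show ?thesis using assoc_mult_mat[OF L1(1) Cc, of "L2\<^sup>T" n2] L2(1) by simp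
  qed
  fix x1 x2 :: "real vec" assume x: "x1 \<in> carrier_vec n1" "x2 \<in> carrier_vec n2"
  define u w where "u = L1\<^sup>T *\<^sub>v x1" and "w = L2\<^sup>T *\<^sub>v x2"
  have u: "u \<in> carrier_vec n1" and w: "w \<in> carrier_vec n2" using L1 L2 x by (auto simp: u_def w_def)
  have Cw: "C *\<^sub>v w \<in> carrier_vec n1" using Cc w by simp
  have L2T: "L2\<^sup>T \<in> carrier_mat n2 n2" and L1T: "L1\<^sup>T \<in> carrier_mat n1 n1" using L1 L2 by auto
  have x12: "x1 @\<^sub>v x2 \<in> carrier_vec (n1 + n2)" using x by simp
  have "P\<^sup>T *\<^sub>v (x1 @\<^sub>v x2) = (u + C *\<^sub>v w) @\<^sub>v w"
  proof -
    have "P\<^sup>T *\<^sub>v (x1 @\<^sub>v x2) = (L1\<^sup>T *\<^sub>v x1 + (C * L2\<^sup>T) *\<^sub>v x2) @\<^sub>v (0\<^sub>m n2 n1 *\<^sub>v x1 + L2\<^sup>T *\<^sub>v x2)"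
      unfolding PT using four_block_mat_mult_vec[OF L1T _ _ L2T x, of "C * L2\<^sup>T" "0\<^sub>m n2 n1"] Cc L2T by simp
    moreover have "0\<^sub>m n2 n1 *\<^sub>v x1 = 0\<^sub>v n2" using x by (auto intro!: eq_vecI)
    ultimately show ?thesis
      using assoc_mult_mat_vec[OF Cc L2T x(2)] w by (simp add: u_def w_def)
  qed
  moreover have "L\<^sup>T *\<^sub>v (x1 @\<^sub>v x2) = Q\<^sup>T *\<^sub>v (P\<^sup>T *\<^sub>v (x1 @\<^sub>v x2))"
    unfolding LPQ transpose_mult[OF P Q] using P Q x12 by (intro assoc_mult_mat_vec) auto
  moreover have "Q\<^sup>T *\<^sub>v ((u + C *\<^sub>v w) @\<^sub>v w) = (u + C *\<^sub>v w) @\<^sub>v (D2\<^sup>T *\<^sub>v w)"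
    unfolding QT using mult_mat_vec_split[of "1\<^sub>m n1" n1 "D2\<^sup>T" n2 "u + C *\<^sub>v w" w] D2c u w Cw by simp
  ultimately have Lx: "L\<^sup>T *\<^sub>v (x1 @\<^sub>v x2) = (u + C *\<^sub>v w) @\<^sub>v (D2\<^sup>T *\<^sub>v w)" by simp
  \<comment> \<open>\<open>D2\<close> is an exact factor of I - T, so this block subtracts the
    retained part of the squared norm of C w.\<close>
  have "(D2\<^sup>T *\<^sub>v w) \<bullet> (D2\<^sup>T *\<^sub>v w) = w \<bullet> w - w \<bullet> (T *\<^sub>v w)"
    using cholesky_factor_quadratic_form[OF D2' IT w] minus_mult_distrib_mat_vec[OF one_carrier_mat T w]
      scalar_prod_minus_distrib[of w n2 w "T *\<^sub>v w"] T w by simp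
  moreover have "(u + C *\<^sub>v w) \<bullet> (u + C *\<^sub>v w) = u \<bullet> u + 2 * (u \<bullet> (C *\<^sub>v w)) + (C *\<^sub>v w) \<bullet> (C *\<^sub>v w)"
    using u Cw comm_scalar_prod[OF u Cw]
    by (simp add: add_scalar_prod_distrib[of _ n1] scalar_prod_add_distrib[of _ n1])
  moreover have "u \<bullet> (C *\<^sub>v w) = x1 \<bullet> (A12 *\<^sub>v x2)"
  proof -
    have "u \<bullet> (C *\<^sub>v w) = x1 \<bullet> (L1 *\<^sub>v (C *\<^sub>v w))"
      unfolding u_def by (rule transpose_vec_mult_scalar[OF L1(1) Cw x(1)])
    also have "L1 *\<^sub>v (C *\<^sub>v w) = (L1 * C * L2\<^sup>T) *\<^sub>v x2"
      unfolding w_def using assoc_mult_mat_vec[OF L1(1) Cc, of "L2\<^sup>T *\<^sub>v x2"]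
        assoc_mult_mat_vec[of "L1 * C" n1 n2 "L2\<^sup>T" n2 x2] L1 L2T Cc x by simp
    finally show ?thesis by (simp add: A12_eq)
  qed
  ultimately have q: "(L\<^sup>T *\<^sub>v (x1 @\<^sub>v x2)) \<bullet> (L\<^sup>T *\<^sub>v (x1 @\<^sub>v x2))
      = u \<bullet> u + w \<bullet> w + 2 * (x1 \<bullet> (A12 *\<^sub>v x2)) + ((C *\<^sub>v w) \<bullet> (C *\<^sub>v w) - w \<bullet> (T *\<^sub>v w))"
    unfolding Lx using scalar_prod_append[of "u + C *\<^sub>v w" n1 "D2\<^sup>T *\<^sub>v w" n2] u w Cw D2c by simp
  note tb = svd_truncation[OF Cc svd tr w V1 S1 \<tau>, folded T_def]
  show "(L1\<^sup>T *\<^sub>v x1) \<bullet> (L1\<^sup>T *\<^sub>v x1) + (L2\<^sup>T *\<^sub>v x2) \<bullet> (L2\<^sup>T *\<^sub>v x2) + 2 * (x1 \<bullet> (A12 *\<^sub>v x2))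
          \<le> (L\<^sup>T *\<^sub>v (x1 @\<^sub>v x2)) \<bullet> (L\<^sup>T *\<^sub>v (x1 @\<^sub>v x2))"
    using tb(1) unfolding q u_def[symmetric] w_def[symmetric] by simp
  show "(L\<^sup>T *\<^sub>v (x1 @\<^sub>v x2)) \<bullet> (L\<^sup>T *\<^sub>v (x1 @\<^sub>v x2))
          \<le> (L1\<^sup>T *\<^sub>v x1) \<bullet> (L1\<^sup>T *\<^sub>v x1) + (1 + \<tau>\<^sup>2) * ((L2\<^sup>T *\<^sub>v x2) \<bullet> (L2\<^sup>T *\<^sub>v x2))
            + 2 * (x1 \<bullet> (A12 *\<^sub>v x2))"
    using tb(2) unfolding q u_def[symmetric] w_def[symmetric] by (simp add: algebra_simps)
qed

section \<open>Induction on the level\<close>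

lemma four_block_quadratic_form:
  fixes A11 :: "real mat"
  assumes A: "A11 \<in> carrier_mat n1 n1" "A12 \<in> carrier_mat n1 n2" "A22 \<in> carrier_mat n2 n2"
    and x: "x1 \<in> carrier_vec n1" "x2 \<in> carrier_vec n2"
  shows "(x1 @\<^sub>v x2) \<bullet> (four_block_mat A11 A12 A12\<^sup>T A22 *\<^sub>v (x1 @\<^sub>v x2))
    = x1 \<bullet> (A11 *\<^sub>v x1) + 2 * (x1 \<bullet> (A12 *\<^sub>v x2)) + x2 \<bullet> (A22 *\<^sub>v x2)"
proof -
  have T: "A12\<^sup>T \<in> carrier_mat n2 n1" using A by simp
  have c: "A11 *\<^sub>v x1 \<in> carrier_vec n1" "A12 *\<^sub>v x2 \<in> carrier_vec n1"
    "A12\<^sup>T *\<^sub>v x1 \<in> carrier_vec n2" "A22 *\<^sub>v x2 \<in> carrier_vec n2" using A x T by auto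
  have "x2 \<bullet> (A12\<^sup>T *\<^sub>v x1) = x1 \<bullet> (A12 *\<^sub>v x2)"
    using transpose_vec_mult_scalar[OF A(2) x(2) x(1)] comm_scalar_prod[OF x(2) c(3)] by simp
  then show ?thesis
    unfolding four_block_mat_mult_vec[OF A(1,2) T A(3) x]
    using x c by (simp add: scalar_prod_append[of _ n1 _ n2] scalar_prod_add_distrib[of _ n1]
        scalar_prod_add_distrib[of _ n2])
qed

text \<open>The number K is quantified inside the conclusion and is not tied to the norm of A. A
  bound on the form of A passes to both diagonal blocks, so the same K serves at every level and no
  norms of blocks have to be compared. The dimension and determinant clauses make the inverses at
  the next level meaningful.\<close>

lemma esif_factor_bounds:
  assumes "esif_factor \<tau> l A L" and \<tau>: "0 \<le> \<tau>" and "A \<in> carrier_mat n n"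
  shows "L \<in> carrier_mat n n \<and> det L \<noteq> 0 \<and>
    (\<forall>K x. 0 \<le> K \<longrightarrow> (\<forall>y\<in>carrier_vec n. y \<bullet> (A *\<^sub>v y) \<le> K * (y \<bullet> y)) \<longrightarrow> x \<in> carrier_vec n \<longrightarrow>
      x \<bullet> (A *\<^sub>v x) \<le> (L\<^sup>T *\<^sub>v x) \<bullet> (L\<^sup>T *\<^sub>v x) \<and>
      (L\<^sup>T *\<^sub>v x) \<bullet> (L\<^sup>T *\<^sub>v x) \<le> x \<bullet> (A *\<^sub>v x) + ((1 + \<tau>\<^sup>2) ^ l - 1) * K * (x \<bullet> x))"
  using assms(1,3)
proof (induction arbitrary: n)
  case (level_0 A L)
  then show ?case
    using cholesky_factor_carrier cholesky_factor_det cholesky_factor_quadratic_form by simp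
next
  case (level_Suc n1 n2 A11 A12 A21 A22 A l L1 L2 C U \<sigma> V r V1 S1 D2 L)
  have n: "n = n1 + n2" using level_Suc by auto
  note IH1 = level_Suc.IH(1)[OF \<open>A11 \<in> carrier_mat n1 n1\<close>]
  note IH2 = level_Suc.IH(2)[OF \<open>A22 \<in> carrier_mat n2 n2\<close>]
  have L1: "L1 \<in> carrier_mat n1 n1" "det L1 \<noteq> 0" and L2: "L2 \<in> carrier_mat n2 n2" "det L2 \<noteq> 0"
    using IH1 IH2 by auto
  note step = esif_step[OF L1 L2 \<open>A12 \<in> carrier_mat n1 n2\<close> level_Suc.hyps(11-17) \<tau>]
  show ?case
  proof (intro conjI allI impI)
    show "L \<in> carrier_mat n n" "det L \<noteq> 0" using step(1,2) n by auto
  next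
    fix K :: real and x :: "real vec"
    assume K: "0 \<le> K" and KA: "\<forall>y\<in>carrier_vec n. y \<bullet> (A *\<^sub>v y) \<le> K * (y \<bullet> y)" and x: "x \<in> carrier_vec n"
    define x1 x2 where "x1 = vec_first x n1" and "x2 = vec_last x n2"
    have xc: "x1 \<in> carrier_vec n1" "x2 \<in> carrier_vec n2" by (auto simp: x1_def x2_def)
    have xx: "x = x1 @\<^sub>v x2" using x n by (simp add: x1_def x2_def)
    have form: "(y1 @\<^sub>v y2) \<bullet> (A *\<^sub>v (y1 @\<^sub>v y2))
        = y1 \<bullet> (A11 *\<^sub>v y1) + 2 * (y1 \<bullet> (A12 *\<^sub>v y2)) + y2 \<bullet> (A22 *\<^sub>v y2)"
      if "y1 \<in> carrier_vec n1" "y2 \<in> carrier_vec n2" for y1 y2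
      using four_block_quadratic_form[OF _ _ _ that] level_Suc.hyps by blast
    \<comment> \<open>Padding y with zeros turns the form of A into that of a diagonal block without
      changing the length of y.\<close>
    have K1: "\<forall>y\<in>carrier_vec n1. y \<bullet> (A11 *\<^sub>v y) \<le> K * (y \<bullet> y)"
    proof
      fix y :: "real vec" assume y: "y \<in> carrier_vec n1"
      have "A12 *\<^sub>v 0\<^sub>v n2 = 0\<^sub>v n1" using \<open>A12 \<in> carrier_mat n1 n2\<close> by (auto intro!: eq_vecI)
      then show "y \<bullet> (A11 *\<^sub>v y) \<le> K * (y \<bullet> y)"
        using KA[rule_format, of "y @\<^sub>v 0\<^sub>v n2"] form[OF y, of "0\<^sub>v n2"] y n \<open>A22 \<in> carrier_mat n2 n2\<close>
          scalar_prod_append[OF y _ y, of "0\<^sub>v n2" n2 "0\<^sub>v n2"] by simp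
    qed
    have K2: "\<forall>y\<in>carrier_vec n2. y \<bullet> (A22 *\<^sub>v y) \<le> K * (y \<bullet> y)"
    proof
      fix y :: "real vec" assume y: "y \<in> carrier_vec n2"
      show "y \<bullet> (A22 *\<^sub>v y) \<le> K * (y \<bullet> y)"
        using KA[rule_format, of "0\<^sub>v n1 @\<^sub>v y"] form[OF _ y, of "0\<^sub>v n1"] y n
          \<open>A11 \<in> carrier_mat n1 n1\<close> \<open>A12 \<in> carrier_mat n1 n2\<close>
          scalar_prod_append[OF _ y _ y, of "0\<^sub>v n1" n1 "0\<^sub>v n1"] by simp
    qed
    define c where "c = (1 + \<tau>\<^sup>2) ^ l"
    define q1 q2 where "q1 = (L1\<^sup>T *\<^sub>v x1) \<bullet> (L1\<^sup>T *\<^sub>v x1)" and "q2 = (L2\<^sup>T *\<^sub>v x2) \<bullet> (L2\<^sup>T *\<^sub>v x2)"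
    define s1 s2 where "s1 = x1 \<bullet> x1" and "s2 = x2 \<bullet> x2"
    define a1 a2 where "a1 = x1 \<bullet> (A11 *\<^sub>v x1)" and "a2 = x2 \<bullet> (A22 *\<^sub>v x2)"
    have c: "1 \<le> c" by (simp add: c_def)
    have b1: "a1 \<le> q1" "q1 \<le> a1 + (c - 1) * K * s1"
      using IH1 K K1 xc by (auto simp: a1_def q1_def s1_def c_def)
    have b2: "a2 \<le> q2" "q2 \<le> a2 + (c - 1) * K * s2"
      using IH2 K K2 xc by (auto simp: a2_def q2_def s2_def c_def)
    have a2: "a2 \<le> K * s2" using K2 xc by (simp add: a2_def s2_def)
    have s: "x \<bullet> x = s1 + s2"
      unfolding xx s1_def s2_def by (rule scalar_prod_append) (use xc in auto)
    have s1: "0 \<le> s1" by (simp add: s1_def scalar_prod_self_nonneg)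
    show "x \<bullet> (A *\<^sub>v x) \<le> (L\<^sup>T *\<^sub>v x) \<bullet> (L\<^sup>T *\<^sub>v x)"
      using step(3)[OF xc] form[OF xc] b1 b2 unfolding xx a1_def a2_def q1_def q2_def by simp
    \<comment> \<open>The truncation error is relative to the approximate form q2, which is at most
      K s2 + (c - 1) K s2 = c K s2. Hence the error constant grows from c - 1 to (c - 1) + \<tau>^2
      c.\<close>
    have "\<tau>\<^sup>2 * q2 \<le> \<tau>\<^sup>2 * (c * K * s2)"
      using b2 a2 by (intro mult_left_mono) (auto simp: algebra_simps)
    \<comment> \<open>Only the second block suffers truncation; this slack gives the first block the
      same constant, so that s1 and s2 combine into x \<bullet> x.\<close>
    moreover have "0 \<le> c * \<tau>\<^sup>2 * K * s1" using c K s1 by simp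
    ultimately have "q1 + (1 + \<tau>\<^sup>2) * q2 \<le> a1 + a2 + ((1 + \<tau>\<^sup>2) ^ Suc l - 1) * K * (s1 + s2)"
      using b1 b2 by (simp add: c_def[symmetric] algebra_simps)
    then show "(L\<^sup>T *\<^sub>v x) \<bullet> (L\<^sup>T *\<^sub>v x) \<le> x \<bullet> (A *\<^sub>v x) + ((1 + \<tau>\<^sup>2) ^ Suc l - 1) * K * (x \<bullet> x)"
      using step(4)[OF xc] form[OF xc] unfolding s unfolding xx a1_def a2_def q1_def q2_def by simp
  qed
qed

section \<open>Quadratic forms against spectral norms\<close>

lemma spd_mat_det:
  assumes A: "A \<in> carrier_mat n n" and spd: "spd_mat A"
  shows "det A \<noteq> 0"
  using det_0_iff_vec_prod_zero[OF A] spd A by (fastforce simp: spd_mat_def)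

lemma spd_mat_nonneg:
  assumes A: "A \<in> carrier_mat n n" and spd: "spd_mat A" and x: "x \<in> carrier_vec n"
  shows "0 \<le> x \<bullet> (A *\<^sub>v x)"
  using assms by (cases "x = 0\<^sub>v n") (auto simp: spd_mat_def less_imp_le)

text \<open>No square root of A is used. For A z = x, Cauchy-Schwarz in the form of A gives (x
  \<bullet> x)^2 \<le> (x \<bullet> A x) (z \<bullet> x), and z \<bullet> x is at most the norm of
  the inverse times x \<bullet> x; one factor x \<bullet> x then cancels.\<close>

lemma spd_mat_quadratic_form_ge:
  assumes A: "A \<in> carrier_mat n n" and spd: "spd_mat A" and x: "x \<in> carrier_vec n" and n: "0 < n"
  shows "x \<bullet> x \<le> spectral_norm (inv_mat A) * (x \<bullet> (A *\<^sub>v x))"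
proof -
  note I = inv_mat_det_nonzero[OF A spd_mat_det[OF A spd]]
  define s where "s = spectral_norm (inv_mat A)"
  define z where "z = inv_mat A *\<^sub>v x"
  have z: "z \<in> carrier_vec n" using I x by (simp add: z_def)
  have Az: "A *\<^sub>v z = x"
    using assoc_mult_mat_vec[OF A I(1) x] I(2) x by (simp add: z_def)
  have "z \<bullet> x \<le> vec_norm2 z * vec_norm2 x" by (rule scalar_prod_le_vec_norm2[OF z x])
  also have "\<dots> \<le> s * vec_norm2 x * vec_norm2 x"
    unfolding z_def s_def
    by (intro mult_right_mono vec_norm2_mult_le_spectral_norm[OF I(1) x] vec_norm2_nonneg)
  finally have zx: "z \<bullet> x \<le> s * (x \<bullet> x)"
    using vec_norm2_square[of x] by (simp add: power2_eq_square mult.assoc)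
  have "(x \<bullet> x)\<^sup>2 \<le> (x \<bullet> (A *\<^sub>v x)) * (z \<bullet> x)"
    using psd_cauchy_schwarz[OF A _ spd_mat_nonneg[OF A spd] x z] spd by (simp add: Az spd_mat_def)
  also have "\<dots> \<le> (x \<bullet> (A *\<^sub>v x)) * (s * (x \<bullet> x))"
    by (intro mult_left_mono zx spd_mat_nonneg[OF A spd x])
  finally have *: "(x \<bullet> x) * (x \<bullet> x) \<le> (x \<bullet> x) * (s * (x \<bullet> (A *\<^sub>v x)))"
    by (simp add: power2_eq_square mult_ac)
  have s0: "0 \<le> s" unfolding s_def by (rule spectral_norm_nonneg[OF I(1) n])
  show ?thesis
  proof (cases "x \<bullet> x = 0")
    case True
    then show ?thesis using s0 spd_mat_nonneg[OF A spd x] by (simp add: s_def[symmetric])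
  next
    case False
    then show ?thesis using * scalar_prod_self_nonneg[of x] by (simp add: s_def[symmetric])
  qed
qed

lemma quadratic_form_le_spectral_norm:
  assumes A: "A \<in> carrier_mat n n" and x: "x \<in> carrier_vec n"
  shows "x \<bullet> (A *\<^sub>v x) \<le> spectral_norm A * (x \<bullet> x)"
proof -
  have "x \<bullet> (A *\<^sub>v x) \<le> vec_norm2 x * vec_norm2 (A *\<^sub>v x)"
    using A x by (intro scalar_prod_le_vec_norm2) auto
  also have "\<dots> \<le> vec_norm2 x * (spectral_norm A * vec_norm2 x)"
    by (intro mult_left_mono vec_norm2_mult_le_spectral_norm[OF A x] vec_norm2_nonneg)
  finally show ?thesis
    using vec_norm2_square[of x] by (simp add: power2_eq_square mult_ac)
qed

section \<open>The preconditioned matrix\<close>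

theorem theorem3p2:
  fixes A L M :: "real mat" and n l :: nat and \<tau> \<epsilon> :: real
  assumes "n > 0" and "A \<in> carrier_mat n n" and "spd_mat A"
    and "l \<ge> 1" and "0 \<le> \<tau>" and "\<tau> < 1"
    and "\<epsilon> = ((1 + \<tau>\<^sup>2) ^ l - 1) * cond2 A"
    and "esif_factor \<tau> l A L"
    and "M = inv_mat L * A * (inv_mat L)\<^sup>T"
  shows "(\<forall>\<mu>. eigenvalue M \<mu> \<longrightarrow> 1 / (1 + \<epsilon>) \<le> \<mu> \<and> \<mu> \<le> 1)
       \<and> spectral_norm (M - 1\<^sub>m n) \<le> \<epsilon> / (1 + \<epsilon>)
       \<and> cond2 M \<le> 1 + \<epsilon>"
proof -
  note n = \<open>n > 0\<close> and A = \<open>A \<in> carrier_mat n n\<close> and spd = \<open>spd_mat A\<close>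
  define K s c where "K = spectral_norm A" and "s = spectral_norm (inv_mat A)"
    and "c = (1 + \<tau>\<^sup>2) ^ l - 1"
  note IA = inv_mat_det_nonzero[OF A spd_mat_det[OF A spd]]
  have K: "0 \<le> K" unfolding K_def by (rule spectral_norm_nonneg[OF A n])
  have s: "0 \<le> s" unfolding s_def by (rule spectral_norm_nonneg[OF IA(1) n])
  have c: "0 \<le> c" by (simp add: c_def)
  have eps: "\<epsilon> = c * K * s" using assms(7) by (simp add: cond2_def K_def s_def c_def)
  have eps0: "0 \<le> \<epsilon>" using c K s by (simp add: eps)
  have L: "L \<in> carrier_mat n n" "det L \<noteq> 0"
    and bnd: "\<And>x. x \<in> carrier_vec n \<Longrightarrow> x \<bullet> (A *\<^sub>v x) \<le> (L\<^sup>T *\<^sub>v x) \<bullet> (L\<^sup>T *\<^sub>v x)"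
      "\<And>x. x \<in> carrier_vec n \<Longrightarrow> (L\<^sup>T *\<^sub>v x) \<bullet> (L\<^sup>T *\<^sub>v x) \<le> x \<bullet> (A *\<^sub>v x) + c * K * (x \<bullet> x)"
    using esif_factor_bounds[OF assms(8,5) A] K quadratic_form_le_spectral_norm[OF A]
    by (auto simp: K_def c_def)
  note IL = inv_mat_det_nonzero[OF L]
  define G where "G = inv_mat L"
  have G: "G \<in> carrier_mat n n" "L * G = 1\<^sub>m n" "G * L = 1\<^sub>m n" using IL by (auto simp: G_def)
  have GT: "G\<^sup>T \<in> carrier_mat n n" and LT: "L\<^sup>T \<in> carrier_mat n n" using G L by auto
  have MG: "M = G * A * G\<^sup>T" using assms(9) by (simp add: G_def)
  have M: "M \<in> carrier_mat n n" using G A by (simp add: MG)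
  have AT: "A\<^sup>T = A" using spd by (simp add: spd_mat_def)
  have MT: "M\<^sup>T = M"
  proof -
    have "M\<^sup>T = G * (G * A)\<^sup>T"
      unfolding MG using transpose_mult[of "G * A" n n "G\<^sup>T" n] G A by simp
    also have "(G * A)\<^sup>T = A * G\<^sup>T" using transpose_mult[OF G(1) A] AT by simp
    finally show ?thesis using assoc_mult_mat[OF G(1) A GT] by (simp add: MG)
  qed
  \<comment> \<open>The substitution y = L^-T x turns the form of M into that of A, and the form of
    \<open>L * L\<^sup>T\<close> into x \<bullet> x.\<close>
  have le: "x \<bullet> (M *\<^sub>v x) \<le> x \<bullet> x" and ge: "x \<bullet> x \<le> (1 + \<epsilon>) * (x \<bullet> (M *\<^sub>v x))"
    if x: "x \<in> carrier_vec n" for x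
  proof -
    define y where "y = G\<^sup>T *\<^sub>v x"
    have y: "y \<in> carrier_vec n" using GT x by (simp add: y_def)
    have "M *\<^sub>v x = G *\<^sub>v (A *\<^sub>v y)"
      unfolding MG y_def using assoc_mult_mat_vec[of "G * A" n n "G\<^sup>T" n x] assoc_mult_mat_vec[OF G(1) A, of "G\<^sup>T *\<^sub>v x"] G A x
      by simp
    then have My: "x \<bullet> (M *\<^sub>v x) = y \<bullet> (A *\<^sub>v y)"
      using transpose_vec_mult_scalar[OF G(1) _ x, of "A *\<^sub>v y"] A y by (simp add: y_def)
    have "L\<^sup>T * G\<^sup>T = 1\<^sub>m n" using transpose_mult[OF G(1) L(1)] G(3) by simp
    then have Ly: "L\<^sup>T *\<^sub>v y = x"
      using assoc_mult_mat_vec[OF LT GT x] x by (simp add: y_def)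
    show "x \<bullet> (M *\<^sub>v x) \<le> x \<bullet> x" using bnd(1)[OF y] by (simp add: My Ly)
    \<comment> \<open>The absolute error c K (y \<bullet> y) becomes relative to y \<bullet> A y at
      the price of s; the product K s is the condition number in \<open>\<epsilon>\<close>.\<close>
    have "c * K * (y \<bullet> y) \<le> c * K * (s * (y \<bullet> (A *\<^sub>v y)))"
      unfolding s_def using c K by (intro mult_left_mono spd_mat_quadratic_form_ge[OF A spd y n]) auto
    then show "x \<bullet> x \<le> (1 + \<epsilon>) * (x \<bullet> (M *\<^sub>v x))"
      using bnd(2)[OF y] by (simp add: My Ly eps algebra_simps)
  qed
  have pos: "0 \<le> x \<bullet> (M *\<^sub>v x)" if "x \<in> carrier_vec n" for x
  proof -
    have "0 \<le> (1 + \<epsilon>) * (x \<bullet> (M *\<^sub>v x))"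
      using ge[OF that] scalar_prod_self_nonneg[of x] by linarith
    then show ?thesis using eps0 by (simp add: zero_le_mult_iff)
  qed
  have "1 / (1 + \<epsilon>) \<le> \<mu> \<and> \<mu> \<le> 1" if ev: "eigenvalue M \<mu>" for \<mu>
  proof -
    obtain v where v: "v \<in> carrier_vec n" "v \<noteq> 0\<^sub>v n" "M *\<^sub>v v = \<mu> \<cdot>\<^sub>v v"
      using ev M by (auto simp: eigenvalue_def eigenvector_def)
    have vv: "0 < v \<bullet> v"
      using vec_norm2_eq_0[of v] v scalar_prod_self_nonneg[of v]
      by (auto simp: vec_norm2_def less_le)
    have "\<mu> * (v \<bullet> v) \<le> 1 * (v \<bullet> v)" "1 * (v \<bullet> v) \<le> ((1 + \<epsilon>) * \<mu>) * (v \<bullet> v)"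
      using le[OF v(1)] ge[OF v(1)] v by simp_all
    then have "\<mu> \<le> 1" "1 \<le> (1 + \<epsilon>) * \<mu>" using vv by (simp_all only: mult_le_cancel_right_pos)
    then show ?thesis using eps0 by (simp add: field_simps)
  qed
  moreover have "spectral_norm (M - 1\<^sub>m n) \<le> \<epsilon> / (1 + \<epsilon>)"
  proof (rule spectral_norm_le[OF minus_carrier_mat[OF one_carrier_mat] n])
    fix x :: "real vec" assume x: "x \<in> carrier_vec n"
    \<comment> \<open>The semidefinite matrix is I - M, not M - I; the sign is removed at the end.
      The constant is 1 - 1/(1 + \<epsilon>).\<close>
    define N where "N = 1\<^sub>m n - M"
    have N: "N \<in> carrier_mat n n" using M unfolding N_def by (rule minus_carrier_mat)
    have Nx: "N *\<^sub>v y = y - M *\<^sub>v y" if "y \<in> carrier_vec n" for y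
      using minus_mult_distrib_mat_vec[OF one_carrier_mat M that] that by (simp add: N_def)
    have NT: "N\<^sup>T = N"
      using M MT by (auto simp: N_def transpose_minus[of _ n n])
    have form: "y \<bullet> (N *\<^sub>v y) = y \<bullet> y - y \<bullet> (M *\<^sub>v y)" if "y \<in> carrier_vec n" for y
      using scalar_prod_minus_distrib[of y n y "M *\<^sub>v y"] that M by (simp add: Nx)
    have "vec_norm2 (N *\<^sub>v x) \<le> \<epsilon> / (1 + \<epsilon>) * vec_norm2 x"
    proof (rule psd_vec_norm2_le[OF N NT _ _ _ x])
      fix y :: "real vec" assume y: "y \<in> carrier_vec n"
      show "0 \<le> y \<bullet> (N *\<^sub>v y)" using le[OF y] form[OF y] by simp
      show "y \<bullet> (N *\<^sub>v y) \<le> \<epsilon> / (1 + \<epsilon>) * (y \<bullet> y)"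
      proof -
        have "(1 + \<epsilon>) * (y \<bullet> (N *\<^sub>v y)) \<le> \<epsilon> * (y \<bullet> y)"
          using ge[OF y] by (simp add: form[OF y] algebra_simps)
        then show ?thesis using eps0 by (simp add: field_simps)
      qed
    qed (use eps0 in simp)
    moreover have "(M - 1\<^sub>m n) *\<^sub>v x = (- 1) \<cdot>\<^sub>v (N *\<^sub>v x)"
      using minus_mult_distrib_mat_vec[OF M one_carrier_mat x] x M
      by (auto simp: Nx intro!: eq_vecI)
    ultimately show "vec_norm2 ((M - 1\<^sub>m n) *\<^sub>v x) \<le> \<epsilon> / (1 + \<epsilon>) * vec_norm2 x"
      by (simp add: vec_norm2_smult del: minus_mult_distrib_mat_vec)
  qed
  moreover have "cond2 M \<le> 1 + \<epsilon>"
  proof -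
    \<comment> \<open>Definiteness follows from \<open>ge\<close> and makes M invertible, so that
      \<open>cond2 M\<close> refers to a genuine inverse.\<close>
    have spdM: "spd_mat M"
      unfolding spd_mat_def
    proof (intro conjI ballI impI)
      show "square_mat M" using M by auto
      show "M\<^sup>T = M" by (rule MT)
      fix x :: "real vec" assume x: "x \<in> carrier_vec (dim_col M)" "x \<noteq> 0\<^sub>v (dim_col M)"
      then have "0 < x \<bullet> x"
        using vec_norm2_eq_0[of x] scalar_prod_self_nonneg[of x] by (auto simp: vec_norm2_def less_le)
      then have "0 < (1 + \<epsilon>) * (x \<bullet> (M *\<^sub>v x))" using ge[of x] x M by auto
      then show "0 < x \<bullet> (M *\<^sub>v x)" using eps0 by (simp add: zero_less_mult_iff)
    qed
    note IM = inv_mat_det_nonzero[OF M spd_mat_det[OF M spdM]]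
    have "spectral_norm M \<le> 1"
      using psd_vec_norm2_le[OF M MT pos, of 1] le by (intro spectral_norm_le[OF M n]) simp
    moreover have "spectral_norm (inv_mat M) \<le> 1 + \<epsilon>"
    proof (rule spectral_norm_le[OF IM(1) n])
      fix y :: "real vec" assume y: "y \<in> carrier_vec n"
      define x where "x = inv_mat M *\<^sub>v y"
      have x: "x \<in> carrier_vec n" using IM(1) y by (simp add: x_def)
      have Mx: "M *\<^sub>v x = y"
        using assoc_mult_mat_vec[OF M IM(1) y] IM(2) y by (simp add: x_def)
      \<comment> \<open>Since M x = y, the lower bound on the form reads as a bound on x \<bullet> x
        by x \<bullet> y; Cauchy-Schwarz then allows one norm of x to be cancelled.\<close>
      have "vec_norm2 x * vec_norm2 x \<le> (1 + \<epsilon>) * (x \<bullet> y)"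
        using ge[OF x] Mx vec_norm2_square[of x] by (simp add: power2_eq_square)
      also have "\<dots> \<le> (1 + \<epsilon>) * (vec_norm2 x * vec_norm2 y)"
        using eps0 by (intro mult_left_mono scalar_prod_le_vec_norm2[OF x y]) simp
      finally have "vec_norm2 x * vec_norm2 x \<le> vec_norm2 x * ((1 + \<epsilon>) * vec_norm2 y)"
        by (simp only: mult_ac)
      then have "vec_norm2 x \<le> (1 + \<epsilon>) * vec_norm2 y"
        using vec_norm2_nonneg[of x] vec_norm2_nonneg[of y] eps0
        by (cases "vec_norm2 x = 0") auto
      then show "vec_norm2 (inv_mat M *\<^sub>v y) \<le> (1 + \<epsilon>) * vec_norm2 y" by (simp add: x_def)
    qed
    ultimately show ?thesis
      unfolding cond2_def using mult_mono[of "spectral_norm M" 1 "spectral_norm (inv_mat M)" "1 + \<epsilon>"]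
        spectral_norm_nonneg[OF IM(1) n] by simp
  qed
  ultimately show ?thesis by blast
qed

end
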